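(* The prime $v$-palindromes (in base $10$) are precisely the primes of the form $$5\cdot 10^m-1 \;=\; 4\underbrace{9\cdots 9}_{m}$$ for some integer $m\geq 4$, such that $$5\cdot 10^m-3 \;=\; 4\underbrace{9\cdots 9}_{m-1}7$$ is also prime. That is, a prime $p$ is a $v$-palindrome if and only if there is an integer $m\ge 4$ with $p=5\cdot 10^m-1$ and $5\cdot 10^m-3$ prime.
   Context: For an integer $n\geq 1$ with decimal representation $n=\sum_{i=0}^{L-1}a_i10^i$, where $0\le a_i\le 9$ and $a_{L-1}\neq 0$, the reverse of $n$ is $r(n):=\sum_{i=0}^{L-1}a_{L-1-i}10^{i}$ (the integer formed by reversing the decimal digits of $n$). The additive function $v\colon\mathbb{N}\to\mathbb{Z}$ (additive means $v(ab)=v(a)+v(b)$ for coprime $a,b$; in particular $v(1)=0$) is defined by $v(p):=p$ for primes $p$ and $v(p^\alpha):=p+\alpha$ for prime powers $p^\alpha$ with $\alpha\geq 2$. An integer $n\geq 1$ is a $v$-palindrome (in base $10$) if $10\nmid n$, $n\neq r(n)$, and $v(n)=v(r(n))$. A prime $v$-palindrome is a $v$-palindrome that is a prime number. *)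

theory Defs
  imports Complex_Main "HOL-Library.Log_Nat" "HOL-Computational_Algebra.Primes"
begin

definition digit :: "nat \<Rightarrow> nat \<Rightarrow> nat" where
  "digit n i = n div 10 ^ i mod 10"

definition digit_reverse :: "nat \<Rightarrow> nat" where
  "digit_reverse n =
     (\<Sum>i<floorlog 10 n. digit n (floorlog 10 n - 1 - i) * 10 ^ i)"

(* The additive function with values p at a prime p and p + k at a prime power p ^ k, k >= 2,
   written out over the prime factorisation; the lemmas v_one, v_mult_coprime, v_prime and
   v_prime_power below are its defining properties. *)
definition v :: "nat \<Rightarrow> int" where
  "v n = (\<Sum>p\<in>prime_factors n.
            if multiplicity p n = 1 then int p else int p + int (multiplicity p n))"

definition v_palindrome :: "nat \<Rightarrow> bool" where
  "v_palindrome n \<longleftrightarrow>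
     n \<ge> 1 \<and> \<not> 10 dvd n \<and> n \<noteq> digit_reverse n \<and> v n = v (digit_reverse n)"

lemma v_one: "v 1 = 0"
  by (simp add: v_def)

lemma v_mult_coprime:
  assumes "coprime a b" "a \<ge> 1" "b \<ge> 1"
  shows "v (a * b) = v a + v b"
proof -
  have nz: "a \<noteq> 0" "b \<noteq> 0" using assms by auto
  have disj: "prime_factors a \<inter> prime_factors b = {}"
    using assms(1) by (auto simp: in_prime_factors_iff dest: coprime_common_divisor)
  have ma: "multiplicity p (a * b) = multiplicity p a" if "p \<in> prime_factors a" for p
  proof -
    have "p \<notin> prime_factors b" using that disj by auto
    then have "\<not> p dvd b" using that nz by (auto simp: in_prime_factors_iff)
    then show ?thesis using that nz
      by (simp add: in_prime_factors_iff prime_elem_multiplicity_mult_distrib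
          not_dvd_imp_multiplicity_0)
  qed
  have mb: "multiplicity p (a * b) = multiplicity p b" if "p \<in> prime_factors b" for p
  proof -
    have "p \<notin> prime_factors a" using that disj by auto
    then have "\<not> p dvd a" using that nz by (auto simp: in_prime_factors_iff)
    then show ?thesis using that nz
      by (simp add: in_prime_factors_iff prime_elem_multiplicity_mult_distrib
          not_dvd_imp_multiplicity_0)
  qed
  have "prime_factors (a * b) = prime_factors a \<union> prime_factors b"
    using nz by (rule prime_factors_product)
  then show ?thesis
    unfolding v_def using disj by (simp add: sum.union_disjoint ma mb cong: sum.cong if_cong)
qed

lemma v_prime:
  assumes "prime p"
  shows "v p = int p"
  using assms by (simp add: v_def prime_prime_factors)

lemma v_prime_power:
  assumes "prime p" "k \<ge> 2"
  shows "v (p ^ k) = int (p + k)"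
proof -
  have "prime_factors (p ^ k) = {p}"
    using assms by (simp add: prime_factorization_prime_power)
  moreover have "multiplicity p (p ^ k) = k"
    using assms by (simp add: multiplicity_same_power)
  ultimately show ?thesis using assms by (simp add: v_def)
qed

lemma decimal_lt:
  fixes a :: "nat \<Rightarrow> nat"
  assumes "\<And>i. i < L \<Longrightarrow> a i \<le> 9"
  shows "(\<Sum>i<L. a i * 10 ^ i) < 10 ^ L"
  using assms
proof (induction L)
  case (Suc L)
  have "(\<Sum>i<L. a i * 10 ^ i) < 10 ^ L" using Suc by simp
  moreover have "a L * 10 ^ L \<le> 9 * 10 ^ L" using Suc.prems by simp
  ultimately show ?case by (simp only: sum.lessThan_Suc power_Suc)
qed simp

lemma digit_decimal:
  fixes a :: "nat \<Rightarrow> nat"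
  assumes "\<And>i. i < L \<Longrightarrow> a i \<le> 9" "j < L"
  shows "digit (\<Sum>i<L. a i * 10 ^ i) j = a j"
  using assms
proof (induction j arbitrary: a L)
  case (0 a L)
  then obtain K where L: "L = Suc K" by (cases L) auto
  have "(\<Sum>i<L. a i * 10 ^ i) = a 0 + 10 * (\<Sum>i<K. a (Suc i) * 10 ^ i)"
    unfolding L sum.lessThan_Suc_shift by (simp add: sum_distrib_left ac_simps)
  then show ?case using 0(1)[of 0] by (simp add: digit_def L)
next
  case (Suc j a L)
  then obtain K where L: "L = Suc K" by (cases L) auto
  have eq: "(\<Sum>i<L. a i * 10 ^ i) = a 0 + 10 * (\<Sum>i<K. a (Suc i) * 10 ^ i)"
    unfolding L sum.lessThan_Suc_shift by (simp add: sum_distrib_left ac_simps)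
  have "(\<Sum>i<L. a i * 10 ^ i) div 10 = (\<Sum>i<K. a (Suc i) * 10 ^ i)"
    unfolding eq using Suc.prems(1)[of 0] L by simp
  then have "digit (\<Sum>i<L. a i * 10 ^ i) (Suc j) = digit (\<Sum>i<K. a (Suc i) * 10 ^ i) j"
    by (simp add: digit_def div_mult2_eq)
  also have "\<dots> = a (Suc j)" using Suc.prems L by (intro Suc.IH) auto
  finally show ?case .
qed

(* digit_reverse agrees with the description via the decimal representation. *)
lemma digit_reverse_decimal:
  fixes a :: "nat \<Rightarrow> nat"
  assumes "L \<ge> 1" "\<And>i. i < L \<Longrightarrow> a i \<le> 9" "a (L - 1) \<noteq> 0"
  shows "digit_reverse (\<Sum>i<L. a i * 10 ^ i) = (\<Sum>i<L. a (L - 1 - i) * 10 ^ i)"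
proof -
  let ?n = "\<Sum>i<L. a i * 10 ^ i"
  have up: "?n < 10 ^ L" using assms by (intro decimal_lt) auto
  have "10 ^ (L - 1) \<le> a (L - 1) * 10 ^ (L - 1)" using assms by simp
  also have "\<dots> \<le> ?n" using assms(1)
    by (intro member_le_sum[where f = "\<lambda>i. a i * 10 ^ i"]) auto
  finally have lo: "10 ^ (L - 1) \<le> ?n" .
  have "floorlog 10 ?n \<le> L" using up by (intro floorlog_leI) auto
  moreover have "L \<le> floorlog 10 ?n" using lo assms(1) by (intro floorlog_geI) auto
  ultimately have "floorlog 10 ?n = L" by simp
  then show ?thesis
    unfolding digit_reverse_def using assms(2)
    by (auto intro!: sum.cong digit_decimal)
qed

end

(*
If p is a prime v-palindrome with reverse r, then v(r) = p > r/10, whereas v is much smaller than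
the identity on numbers without a large prime factor: once p > 120, this forces r = kq with q
prime and 2 <= k <= 9. Hence r = kp - k v(k), and comparing first and last digits leaves only
k = 2, p = 4...9 and k = 3, p = 2...7; the latter is impossible modulo 9. For k = 2 the equation
r = 2p - 4, peeled two outer digits at a time, makes every inner digit of p equal to 9.
*)
theory Submission
  imports Defs
begin

section \<open>Digit blocks, their reversals, and the removal of outer digits\<close>

text \<open>The explicit length \<open>n\<close> admits blocks with leading zeros. Such blocks arise
  when outer digits are stripped, and \<open>digit_reverse\<close> would shorten them.\<close>

definition dec :: "(nat \<Rightarrow> nat) \<Rightarrow> nat \<Rightarrow> nat" where
  "dec a n = (\<Sum>i<n. a i * 10 ^ i)"

definition rdec :: "(nat \<Rightarrow> nat) \<Rightarrow> nat \<Rightarrow> nat" where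
  "rdec a n = (\<Sum>i<n. a (n - 1 - i) * 10 ^ i)"

lemma dec_less: "(\<And>i. i < n \<Longrightarrow> a i \<le> 9) \<Longrightarrow> dec a n < 10 ^ n"
  unfolding dec_def by (rule decimal_lt)

lemma rdec_less: "(\<And>i. i < n \<Longrightarrow> a i \<le> 9) \<Longrightarrow> rdec a n < 10 ^ n"
  unfolding rdec_def by (rule decimal_lt) auto

lemma dec_peel:
  "dec a (Suc (Suc n)) = a 0 + 10 * dec (\<lambda>i. a (Suc i)) n + 10 ^ Suc n * a (Suc n)"
  unfolding dec_def sum.lessThan_Suc[of _ "Suc n"] sum.lessThan_Suc_shift[of _ n]
  by (simp add: sum_distrib_left ac_simps)

lemma rdec_peel:
  "rdec a (Suc (Suc n)) = a (Suc n) + 10 * rdec (\<lambda>i. a (Suc i)) n + 10 ^ Suc n * a 0"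
proof -
  have "rdec a (Suc (Suc n)) = dec (\<lambda>i. a (Suc n - i)) (Suc (Suc n))"
    by (simp add: dec_def rdec_def)
  also have "\<dots> = a (Suc n) + 10 * dec (\<lambda>i. a (n - i)) n + 10 ^ Suc n * a 0"
    by (simp add: dec_peel)
  also have "dec (\<lambda>i. a (n - i)) n = rdec (\<lambda>i. a (Suc i)) n"
    unfolding dec_def rdec_def by (intro sum.cong) (auto simp: Suc_diff_Suc)
  finally show ?thesis .
qed

lemma dec_mod_9: "dec a n mod 9 = (\<Sum>i<n. a i) mod 9"
proof -
  have "(10::nat) ^ i mod 9 = 1" for i
    using power_mod[of "10::nat" 9 i] by simp
  then have *: "a i * 10 ^ i mod 9 = a i mod 9" for i
    using mod_mult_right_eq[of "a i" "10 ^ i" 9] by simp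
  have "dec a n mod 9 = (\<Sum>i<n. a i * 10 ^ i mod 9) mod 9"
    unfolding dec_def by (rule mod_sum_eq[symmetric])
  also have "\<dots> = (\<Sum>i<n. a i) mod 9"
    unfolding * by (rule mod_sum_eq)
  finally show ?thesis .
qed

text \<open>Reversal preserves the digit sum. This later excludes the cofactor 3.\<close>

lemma rdec_mod_9: "rdec a n mod 9 = dec a n mod 9"
proof -
  have "rdec a n = dec (\<lambda>i. a (n - 1 - i)) n"
    by (simp add: dec_def rdec_def)
  moreover have "(\<Sum>i<n. a (n - 1 - i)) = (\<Sum>i<n. a i)"
    using sum.nat_diff_reindex[of a n] by simp
  ultimately show ?thesis by (simp add: dec_mod_9)
qed

text \<open>The digit function is bounded at every index, so shifted copies of it need no side
  conditions; the length \<open>Suc (Suc n)\<close> exposes both outer digits for peeling.\<close>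

lemma obtain_digits:
  assumes "p \<ge> 10"
  obtains a n where "\<And>i. a i \<le> 9" "a (Suc n) \<noteq> 0"
    "p = dec a (Suc (Suc n))" "digit_reverse p = rdec a (Suc (Suc n))"
proof -
  have ex: "\<exists>a n. (\<forall>i. a i \<le> 9) \<and> a n \<noteq> 0 \<and> p = dec a (Suc n)" if "p > 0" for p
    using that
  proof (induction p rule: less_induct)
    case (less p)
    show ?case
    proof (cases "p < 10")
      case True
      then show ?thesis using less.prems
        by (intro exI[of _ "\<lambda>_. p"] exI[of _ 0]) (auto simp: dec_def)
    next
      case False
      then have "p div 10 < p" "p div 10 > 0" by auto
      from less.IH[OF this] obtain a n where an:
        "\<And>i. a i \<le> 9" "a n \<noteq> 0" "p div 10 = dec a (Suc n)" by blast
      let ?b = "\<lambda>i. case i of 0 \<Rightarrow> p mod 10 | Suc j \<Rightarrow> a j"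
      have "dec ?b (Suc (Suc n)) = p mod 10 + 10 * dec a (Suc n)"
        unfolding dec_def sum.lessThan_Suc_shift[of _ "Suc n"]
        by (simp add: sum_distrib_left ac_simps)
      also have "\<dots> = p" using an(3) by presburger
      finally have "p = dec ?b (Suc (Suc n))" ..
      moreover have "?b i \<le> 9" for i using an(1) by (auto split: nat.split)
      ultimately show ?thesis using an(2)
        by (intro exI[of _ ?b] exI[of _ "Suc n"]) auto
    qed
  qed
  from ex[of p] assms obtain a m where a: "\<And>i. a i \<le> 9" "a m \<noteq> 0" "p = dec a (Suc m)" by auto
  have "m \<noteq> 0"
  proof
    assume "m = 0"
    then have "p = a 0" using a(3) by (simp add: dec_def)
    then show False using a(1)[of 0] assms by simp
  qed
  then obtain n where m: "m = Suc n" by (cases m) auto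
  have "digit_reverse p = rdec a (Suc (Suc n))"
    unfolding a(3) m dec_def rdec_def using a(1,2) m by (intro digit_reverse_decimal) auto
  with a m show thesis by (intro that[of a n]) auto
qed

text \<open>For \<open>p = 4t9\<close> with inner digit block \<open>t\<close>, the equation \<open>r = 2p - 4\<close> becomes the hypothesis
  below; it is inherited by the block obtained on removing the two outer digits of \<open>t\<close>.\<close>
lemma all_nines:
  assumes "\<And>i. a i \<le> 9" "rdec a n + 10 ^ n = 1 + 2 * dec a n"
  shows "dec a n + 1 = 10 ^ n"
  using assms
proof (induction n arbitrary: a rule: induct_nat_012)
  case (ge2 n)
  define x y t s B where "x = a (Suc n)" and "y = a 0" and "t = dec (\<lambda>i. a (Suc i)) n"
    and "s = rdec (\<lambda>i. a (Suc i)) n" and "B = (10::nat) ^ n"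
  have le: "x \<le> 9" "y \<le> 9" "t < B" "s < B"
    unfolding x_def y_def t_def s_def B_def using ge2.prems(1)
    by (auto intro!: dec_less rdec_less)
  have eq: "x + 10 * s + 10 * B * y + 100 * B = 1 + 2 * (y + 10 * t + 10 * B * x)"
    using ge2.prems(2) unfolding dec_peel rdec_peel x_def y_def t_def s_def B_def by simp
  have last: "x mod 10 = (1 + 2 * y) mod 10"
  proof -
    have "(x + 10 * (s + B * y + 10 * B)) mod 10 = (1 + 2 * y + 10 * (2 * t + 2 * B * x)) mod 10"
      using eq by (simp add: algebra_simps)
    then show ?thesis by (simp only: mod_mult_self2)
  qed
  \<comment> \<open>Discarding the lower digits by means of \<open>s < B\<close> and
    \<open>t < B\<close> compares the leading parts of both sides up to one carry. Together with
    \<open>last\<close>, which determines \<open>x\<close> from \<open>y\<close>, this leaves only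
    the digit 9.\<close>
  have "(y + 10) * B < (2 * x + 2) * B" "2 * x * B < (y + 11) * B"
    using eq le by (simp_all add: algebra_simps)
  then have bounds: "y + 10 < 2 * x + 2" "2 * x < y + 11"
    by (simp_all only: mult_less_cancel2)
  have x: "x = (1 + 2 * y) mod 10" using last le(1) by simp
  have "y = 0 \<or> y = 1 \<or> y = 2 \<or> y = 3 \<or> y = 4 \<or> y = 5 \<or> y = 6 \<or> y = 7 \<or> y = 8 \<or> y = 9"
    using le(2) by presburger
  then have "x = 9 \<and> y = 9"
    using x bounds by (elim disjE) simp_all
  then have xy: "x = 9" "y = 9" by simp_all
  then have "s + B = 1 + 2 * t" using eq by simp
  then have "t + 1 = B"
    unfolding s_def B_def t_def using ge2.prems(1) by (intro ge2.IH(1)) auto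
  then show ?case using xy unfolding dec_peel x_def y_def t_def B_def by simp
qed (auto simp: dec_def rdec_def)

section \<open>Upper bounds for \<open>v\<close>\<close>

text \<open>For \<open>a\<close> and \<open>b\<close> at least 2 a sum never exceeds the product,
  since \<open>(a - 1) * (b - 1) \<ge> 1\<close>.\<close>

lemma v_mult_coprime_le:
  assumes "coprime a b" "v a \<le> int a" "v b \<le> int b" "a \<ge> 2" "b \<ge> 2"
  shows "v (a * b) \<le> int (a * b)"
proof -
  obtain c d where "a = 2 + c" "b = 2 + d"
    using assms(4,5) le_Suc_ex by metis
  then have "a + b \<le> a * b" by (simp add: algebra_simps)
  then show ?thesis using assms v_mult_coprime[of a b] by linarith
qed

lemma v_prime_power_le:
  assumes "prime p" shows "v (p ^ k) \<le> int (p ^ k)"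
proof -
  have p: "p \<ge> 2" using assms by (rule prime_ge_2_nat)
  consider "k = 0" | "k = 1" | "k \<ge> 2" by linarith
  then show ?thesis
  proof cases
    case 3
    then have "p + k \<le> p ^ k"
    proof (induction k rule: dec_induct)
      case base
      have "2 * p \<le> p ^ 2" using p by (simp add: power2_eq_square)
      then show ?case using p by linarith
    next
      case (step k)
      have "2 * p ^ k \<le> p ^ Suc k" using p by simp
      then show ?case using step.IH p by linarith
    qed
    then show ?thesis using v_prime_power[OF assms 3] by linarith
  qed (use assms v_one v_prime in auto)
qed

text \<open>Splitting off the full power of one prime makes the additivity of \<open>v\<close>
  usable in an induction on \<open>n\<close>.\<close>

lemma prime_power_coprime_decomp:
  fixes n :: nat
  assumes "n > 1"
  obtains p k m where "prime p" "k > 0" "n = p ^ k * m" "coprime (p ^ k) m" "m > 0" "m < n"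
proof -
  from assms obtain p where p: "prime p" "p dvd n" using prime_factor_nat[of n] by auto
  obtain m where m: "n = p ^ multiplicity p n * m" "\<not> p dvd m"
    using multiplicity_decompose'[of n p] assms not_prime_unit p(1) by (metis not_one_less_zero)
  have k: "multiplicity p n > 0"
    using p assms by (simp add: prime_multiplicity_gt_zero_iff)
  have c: "coprime (p ^ multiplicity p n) m"
    using m(2) p(1) by (simp add: prime_imp_coprime)
  have "m > 0" using m assms by (cases m) auto
  moreover have "m < n"
  proof -
    have "1 < p ^ multiplicity p n" using k prime_gt_1_nat[OF p(1)] by (rule one_less_power[rotated])
    then have "1 * m < p ^ multiplicity p n * m" using \<open>m > 0\<close> by (intro mult_strict_right_mono) auto
    then show ?thesis using m(1) by simp
  qed
  ultimately show thesis using that p(1) k m(1) c by blast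
qed

lemma v_le: "n > 0 \<Longrightarrow> v n \<le> int n"
proof (induction n rule: less_induct)
  case (less n)
  show ?case
  proof (cases "n = 1")
    case False
    with less.prems have "n > 1" by simp
    then obtain p k m where d: "prime p" "k > 0" "n = p ^ k * m" "coprime (p ^ k) m" "m > 0" "m < n"
      by (rule prime_power_coprime_decomp)
    show ?thesis
    proof (cases "m = 1")
      case True
      then show ?thesis using d v_prime_power_le by simp
    next
      case False
      have "p ^ k \<ge> 2" using d(1,2) prime_ge_2_nat[of p] self_le_power[of p k] by linarith
      then show ?thesis unfolding d(3) using False d less.IH[of m]
        by (intro v_mult_coprime_le v_prime_power_le) auto
    qed
  qed (simp add: v_one[simplified])
qed

text \<open>Used to exclude \<open>b = p ^ k\<close> with \<open>k \<ge> 2\<close> as a cofactor: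
  111 is what \<open>v n > 120\<close> leaves for \<open>v b\<close> after a part of at most 10, and
  the summand 10 pays for the contribution of that part.\<close>

lemma power_dominates:
  fixes p k :: nat
  assumes "p \<ge> 2" "k \<ge> 2" "p + k \<ge> 111"
  shows "10 * (p + k) + 10 \<le> p ^ k"
proof (cases "p \<ge> 14")
  case True
  from assms(2) show ?thesis
  proof (induction k rule: dec_induct)
    case base
    have "14 * p \<le> p ^ 2" using True by (simp add: power2_eq_square)
    then show ?case using True by simp
  next
    case (step k)
    have "2 * p ^ k \<le> p ^ Suc k" using assms by simp
    moreover have "10 * p + 10 * k + 10 \<le> p ^ k" using step.IH by simp
    ultimately have "10 * p + 10 * k + 20 \<le> p ^ Suc k" by linarith
    then show ?case by simp
  qed
next
  case False
  \<comment> \<open>Here \<open>p \<le> 13\<close>, so the exponent is at least 111 - 13, and base 2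
    already suffices.\<close>
  then have "k \<ge> 98" using assms by linarith
  then have "10 * (14 + k) + 10 \<le> 2 ^ k"
  proof (induction k rule: dec_induct)
    case (step k)
    then show ?case by simp
  qed simp
  also have "2 ^ k \<le> p ^ k" using assms by (simp add: power_mono)
  finally show ?thesis using False by simp
qed

section \<open>Numbers with a large value of \<open>v\<close>\<close>

text \<open>Otherwise \<open>a * b < 10 * (a + b)\<close>, that is
  \<open>(a - 10) * (b - 10) < 100\<close> with both factors positive. Then
  \<open>a + b \<le> 120\<close>, against \<open>v n > 120\<close>; this is the origin of the
  threshold.\<close>

lemma large_v_unitary_divisor:
  assumes n: "n > 0" "int n < 10 * v n" "v n > 120"
    and ab: "n = a * b" "coprime a b"
  shows "a \<le> 10 \<or> b \<le> 10"
proof (rule ccontr)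
  assume "\<not> ?thesis"
  then obtain c d where cd: "a = 11 + c" "b = 11 + d"
    using le_Suc_ex[of 11 a] le_Suc_ex[of 11 b] by auto
  have "v n = v a + v b" using ab cd by (simp add: v_mult_coprime)
  also have "\<dots> \<le> int (a + b)" using v_le[of a] v_le[of b] cd by simp
  finally have *: "v n \<le> int (a + b)" .
  moreover have "int (a * b) < 10 * v n" using n(2) ab(1) by simp
  ultimately have "int (a * b) < 10 * int a + 10 * int b" by linarith
  then have "a * b < 10 * a + 10 * b" by linarith
  then have "c + d + c * d < 99" by (simp add: cd algebra_simps)
  then show False using * n cd by linarith
qed

text \<open>A coprime factor \<open>a \<le> 10\<close> chosen as large as possible leaves a prime
  power as cofactor, and \<open>power_dominates\<close> forces its exponent to be 1.\<close>

lemma large_v_structure: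
  assumes n: "n > 0" "int n < 10 * v n" "v n > 120"
  obtains k q where "0 < k" "k \<le> 10" "prime q" "n = k * q" "coprime k q"
proof -
  let ?P = "\<lambda>a. a \<le> 10 \<and> (\<exists>b. n = a * b \<and> coprime a b)"
  \<comment> \<open>If the cofactor of the largest such \<open>a\<close> split further, both parts would again be at most 10,
    making \<^term>\<open>v n\<close> at most 30.\<close>
  define a where "a = (GREATEST a. ?P a)"
  have a: "?P a" unfolding a_def by (rule GreatestI_nat[of ?P 1 10]) auto
  have max: "y \<le> a" if "?P y" for y
    unfolding a_def by (rule Greatest_le_nat[of ?P y 10]) (use that in auto)
  from a obtain b where b: "n = a * b" "coprime a b" "a \<le> 10" by blast
  have pos: "a > 0" "b > 0" using b n(1) by auto
  have vn: "v n = v a + v b" using b pos by (simp add: v_mult_coprime)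
  have va: "v a \<le> int a" "v b \<le> int b" using v_le pos by auto
  have "b > 1" using vn va n b by linarith
  then obtain q k m where d: "prime q" "k > 0" "b = q ^ k * m" "coprime (q ^ k) m" "m > 0"
    by (rule prime_power_coprime_decomp)
  have q2: "q \<ge> 2" using d(1) by (rule prime_ge_2_nat)
  have qk2: "q ^ k \<ge> 2" using d(2) q2 self_le_power[of q k] by linarith
  have "m = 1"
  proof (rule ccontr)
    assume "m \<noteq> 1"
    then have m2: "m \<ge> 2" using d by simp
    have cop: "coprime a (q ^ k)" "coprime a m" using b d by auto
    \<comment> \<open>If \<open>x\<close> exceeded 10, its complement \<open>a * y\<close> would be
      at most 10 and would beat the maximal \<open>a\<close>.\<close>
    have *: "x \<le> 10" if "n = x * (a * y)" "coprime x y" "coprime a x" "coprime a y" "y \<ge> 2" for x y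
    proof (rule ccontr)
      assume "\<not> x \<le> 10"
      moreover have "coprime x (a * y)" using that by (simp add: coprime_commute)
      ultimately have "a * y \<le> 10" using large_v_unitary_divisor[OF n that(1)] by simp
      moreover have "coprime (a * y) x" "n = (a * y) * x" using that by (auto simp: coprime_commute)
      ultimately have "a * y \<le> a" using max by blast
      then show False using that pos by simp
    qed
    have "m \<le> 10" using b d cop qk2
      by (intro *[of m "q ^ k"]) (auto simp: coprime_commute ac_simps)
    moreover have "q ^ k \<le> 10" using b d cop m2
      by (intro *[of "q ^ k" m]) (auto simp: coprime_commute ac_simps)
    moreover have "v b = v (q ^ k) + v m" using d qk2 by (simp add: v_mult_coprime)
    ultimately have "v b \<le> 20" using v_le[of m] v_le[of "q ^ k"] d qk2 by linarith
    then show False using n vn va b by linarith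
  qed
  then have bq: "b = q ^ k" using d by simp
  have "k = 1"
  proof (rule ccontr)
    assume "k \<noteq> 1"
    then have k2: "k \<ge> 2" using d by simp
    then have vb: "v b = int (q + k)" using bq d v_prime_power by simp
    then have "q + k \<ge> 111" using vn va n b by linarith
    then have dom: "10 * (q + k) + 10 \<le> b" using bq power_dominates q2 k2 by blast
    have "v n \<le> int (a + (q + k))" using vn vb va(1) by linarith
    moreover have "int (a * b) < 10 * v n" using n(2) b(1) by simp
    ultimately have "int (a * b) < 10 * int a + 10 * int q + 10 * int k" by linarith
    then have "a * b < 10 * a + 10 * q + 10 * k" by linarith
    \<comment> \<open>Since \<open>a \<ge> 1\<close>, the bound \<open>dom\<close> gives
      \<open>a * b \<ge> 10 * a + 10 * (q + k)\<close>; the substitutions remove the subtractions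
      from this estimate.\<close>
    moreover obtain c where c: "a = Suc c" using pos by (cases a) auto
    moreover obtain e where e: "b = e + 10 * (q + k) + 10"
      using dom by (metis add.assoc add.commute le_Suc_ex)
    ultimately show False by (simp add: algebra_simps)
  qed
  then show thesis using that b pos d bq by auto
qed

section \<open>Primes below 121\<close>

lemma prime_eq_divisor:
  fixes p d :: nat
  assumes "prime p" "d dvd p" "d > 1"
  shows "p = d"
  using assms unfolding prime_nat_iff by (metis less_not_refl)

text \<open>As 121 is the square of 11, trial division by 2, 3, 5 and 7 suffices.\<close>

lemma prime_less_121:
  fixes p :: nat
  assumes "prime p" "p < 121"
  shows "p \<in> {2, 3, 5, 7, 11, 13, 17, 19, 23, 29, 31, 37, 41, 43, 47, 53, 59, 61, 67, 71, 73, 79,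
    83, 89, 97, 101, 103, 107, 109, 113}"
proof -
  note * = prime_eq_divisor[OF assms(1)]
  have "list_all (\<lambda>p. 2 dvd p \<or> 3 dvd p \<or> 5 dvd p \<or> 7 dvd p \<or> p \<in> set [1, 11, 13, 17, 19, 23,
    29, 31, 37, 41, 43, 47, 53, 59, 61, 67, 71, 73, 79, 83, 89, 97, 101, 103, 107, 109, 113])
    [0..<121]"
    by code_simp
  then have "2 dvd p \<or> 3 dvd p \<or> 5 dvd p \<or> 7 dvd p \<or> p \<in> {1, 11, 13, 17, 19, 23, 29, 31, 37,
    41, 43, 47, 53, 59, 61, 67, 71, 73, 79, 83, 89, 97, 101, 103, 107, 109, 113}"
    using assms(2) by (simp add: list_all_iff)
  then show ?thesis using *[of 2] *[of 3] *[of 5] *[of 7] assms(1) by auto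
qed

lemma v_mult_primes:
  assumes "prime p" "prime q" "p \<noteq> q"
  shows "v (p * q) = int p + int q"
  using v_mult_coprime[OF primes_coprime[OF assms]] v_prime[OF assms(1)] v_prime[OF assms(2)]
    prime_ge_1_nat[OF assms(1)] prime_ge_1_nat[OF assms(2)]
  by simp

text \<open>The thirty smaller primes are checked one by one, so that
  \<open>v (digit_reverse p) = p\<close> exceeds the threshold 120 of
  \<open>large_v_structure\<close>.\<close>

lemma v_palindrome_prime_ge_121:
  assumes "prime p" "v_palindrome p"
  shows "p \<ge> 121"
proof (rule ccontr)
  assume "\<not> ?thesis"
  then have p: "p \<in> {2, 3, 5, 7, 11, 13, 17, 19, 23, 29, 31, 37, 41, 43, 47, 53, 59, 61, 67, 71, 73,
    79, 83, 89, 97, 101, 103, 107, 109, 113}"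
    using prime_less_121 assms(1) by simp
  have neq: "p \<noteq> digit_reverse p" and veq: "v (digit_reverse p) = int p"
    using assms by (simp_all add: v_palindrome_def v_prime)
  have rev: "digit_reverse 2 = 2" "digit_reverse 3 = 3" "digit_reverse 5 = 5"
    "digit_reverse 7 = 7" "digit_reverse 11 = 11" "digit_reverse 13 = 31"
    "digit_reverse 17 = 71" "digit_reverse 19 = 91" "digit_reverse 23 = 32"
    "digit_reverse 29 = 92" "digit_reverse 31 = 13" "digit_reverse 37 = 73"
    "digit_reverse 41 = 14" "digit_reverse 43 = 34" "digit_reverse 47 = 74"
    "digit_reverse 53 = 35" "digit_reverse 59 = 95" "digit_reverse 61 = 16"
    "digit_reverse 67 = 76" "digit_reverse 71 = 17" "digit_reverse 73 = 37"
    "digit_reverse 79 = 97" "digit_reverse 83 = 38" "digit_reverse 89 = 98"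
    "digit_reverse 97 = 79" "digit_reverse 101 = 101" "digit_reverse 103 = 301"
    "digit_reverse 107 = 701" "digit_reverse 109 = 901" "digit_reverse 113 = 311"
    by code_simp+
  have "prime (701::nat)" "prime (311::nat)" by code_simp+
  from this[THEN v_prime] have v3: "v 701 = 701" "v 311 = 311" by simp_all
  have vp: "v 31 = 31" "v 71 = 71" "v 13 = 13" "v 73 = 73" "v 17 = 17" "v 37 = 37" "v 97 = 97"
    "v 79 = 79"
    using v_prime[of 31] v_prime[of 71] v_prime[of 13] v_prime[of 73] v_prime[of 17] v_prime[of 37]
      v_prime[of 97] v_prime[of 79]
    by simp_all
  \<comment> \<open>These serve 76, 92 and 98, the reversals that are neither prime powers nor
    products of two distinct primes.\<close>
  have cop: "coprime 4 (19::nat)" "coprime 4 (23::nat)" "coprime 2 (49::nat)"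
    by (simp_all add: coprime_iff_gcd_eq_1 gcd_non_0_nat)
  have vc: "v 91 = 20" "v 34 = 19" "v 14 = 9" "v 74 = 39" "v 35 = 12" "v 95 = 24" "v 38 = 21"
    "v 301 = 50" "v 901 = 70"
    using v_mult_primes[of 7 13] v_mult_primes[of 2 17] v_mult_primes[of 2 7]
      v_mult_primes[of 2 37] v_mult_primes[of 5 7] v_mult_primes[of 5 19]
      v_mult_primes[of 2 19] v_mult_primes[of 7 43] v_mult_primes[of 17 53]
    by simp_all
  have vpow: "v 32 = 7" "v 16 = 6" "v 4 = 4" "v 49 = 9"
    using v_prime_power[of 2 5] v_prime_power[of 2 4] v_prime_power[of 2 2] v_prime_power[of 7 2]
    by simp_all
  have vm: "v 76 = 23" "v 92 = 27" "v 98 = 11"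
    using v_mult_coprime[OF cop(1)] v_mult_coprime[OF cop(2)] v_mult_coprime[OF cop(3)]
      v_prime[of 2] v_prime[of 19] v_prime[of 23] vpow
    by simp_all
  from p neq veq show False
    by (elim insertE) (simp_all add: rev v3 vp vc vpow vm)
qed

section \<open>Finite constraints on the cofactor and the outer digits\<close>

text \<open>Tabulates the offset in \<open>r = k * p - k * v k\<close> for the cofactors that can
  occur.\<close>

lemma mult_v_2_to_9:
  assumes "k \<in> {2, 3, 4, 5, 6, 7, 8, 9}"
  shows "(k, k * nat (v k)) \<in>
    set [(2, 4), (3, 9), (4, 16), (5, 25), (6, 30), (7, 49), (8, 40), (9, 45)]"
proof -
  have "v 2 = 2" "v 3 = 3" "v 5 = 5" "v 7 = 7" "v 4 = 4" "v 8 = 5" "v 9 = 5" "v 6 = 5"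
    using v_prime[of 2] v_prime[of 3] v_prime[of 5] v_prime[of 7] v_prime_power[of 2 2]
      v_prime_power[of 2 3] v_prime_power[of 3 2] v_mult_primes[of 2 3]
    by simp_all
  then show ?thesis using assms by (elim insertE) simp_all
qed

lemma last_digit_of_prime:
  fixes p :: nat
  assumes "prime p" "p > 5"
  shows "p mod 10 \<in> {1, 3, 7, 9}"
proof -
  have "\<not> 2 dvd p" "\<not> 5 dvd p"
    using prime_eq_divisor[OF assms(1), of 2] prime_eq_divisor[OF assms(1), of 5] assms(2) by auto
  then have "p mod 10 mod 2 \<noteq> 0" "p mod 10 mod 5 \<noteq> 0"
    by (simp_all add: mod_mod_cancel dvd_eq_mod_eq_0)
  moreover have "y \<in> {1, 3, 7, 9}" if "y < 10" "y mod 2 \<noteq> 0" "y mod 5 \<noteq> 0" for y :: nat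
  proof -
    have "y \<in> {0, 1, 2, 3, 4, 5, 6, 7, 8, 9}"
      using that(1) by (simp only: insert_iff empty_iff) presburger
    then show ?thesis using that(2,3) by (elim insertE) simp_all
  qed
  ultimately show ?thesis by simp
qed

text \<open>Here \<open>c = k v(k)\<close>, and \<open>x\<close>, \<open>y\<close> are the first and last digits of a prime \<open>p\<close> with reverse
  \<open>kp - c\<close>.\<close>
lemma outer_digits:
  fixes k c x y :: nat
  assumes "(k, c) \<in> set [(2, 4), (3, 9), (4, 16), (5, 25), (6, 30), (7, 49), (8, 40), (9, 45)]"
    and "y \<in> set [1, 3, 7, 9]" and "x \<in> set [1, 2, 3, 4, 5, 6, 7, 8, 9]"
    and "(x + c) mod 10 = k * y mod 10" and "k * x \<le> y + 1" and "k * x = y + 1 \<Longrightarrow> k * y < c"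
  shows "k = 2 \<and> x = 4 \<and> y = 9 \<or> k = 3 \<and> x = 2 \<and> y = 7"
proof -
  let ?P = "\<lambda>k c x y. (x + c) mod 10 = k * y mod 10 \<longrightarrow> k * x \<le> y + 1 \<longrightarrow>
    (k * x = y + 1 \<longrightarrow> k * y < c) \<longrightarrow> k = 2 \<and> x = 4 \<and> y = 9 \<or> k = 3 \<and> x = 2 \<and> y = 7"
  have "\<forall>kc \<in> set [(2 :: nat, 4 :: nat), (3, 9), (4, 16), (5, 25), (6, 30), (7, 49), (8, 40),
    (9, 45)]. \<forall>y \<in> set [1 :: nat, 3, 7, 9]. \<forall>x \<in> set [1 :: nat, 2, 3, 4, 5, 6, 7, 8, 9].
      ?P (fst kc) (snd kc) x y"
    by code_simp
  from bspec[OF bspec[OF bspec[OF this assms(1)] assms(2)] assms(3)] assms(4-6)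
  show ?thesis by simp
qed

section \<open>The shape of a prime v-palindrome\<close>

text \<open>The reverse \<open>r\<close> has no more digits than \<open>p\<close>, so
  \<open>r < 10 * p = 10 * v r\<close> and \<open>large_v_structure\<close> applies. The cofactor 10
  fails because \<open>r\<close> ends in the nonzero leading digit of \<open>p\<close>; the cofactor
  1 would give \<open>r = q = p\<close>.\<close>

lemma v_palindrome_prime_reverse:
  assumes "prime p" "v_palindrome p"
  obtains k q where "prime q" "1 < k" "k < 10" "digit_reverse p = k * q" "int p = v k + int q"
proof -
  have p: "p \<ge> 121" using v_palindrome_prime_ge_121 assms .
  then have "p \<ge> 10" by simp
  then obtain a n where a: "\<And>i. a i \<le> 9" "a (Suc n) \<noteq> 0" "p = dec a (Suc (Suc n))"
    "digit_reverse p = rdec a (Suc (Suc n))" by (rule obtain_digits) blast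
  let ?r = "digit_reverse p"
  have r: "?r = a (Suc n) + 10 * rdec (\<lambda>i. a (Suc i)) n + 10 ^ Suc n * a 0"
    using a(4) rdec_peel by simp
  then have rpos: "?r > 0" using a(2) by simp
  have "?r mod 10 = (a (Suc n) + 10 * (rdec (\<lambda>i. a (Suc i)) n + 10 ^ n * a 0)) mod 10"
    unfolding r by (simp add: algebra_simps)
  also have "\<dots> = a (Suc n)" unfolding mod_mult_self2 using a(1)[of "Suc n"] by simp
  finally have not10: "\<not> 10 dvd ?r" using a(2) by (simp add: dvd_eq_mod_eq_0)
  have "?r < 10 * 10 ^ Suc n" unfolding a(4) using rdec_less[of "Suc (Suc n)" a] a(1) by simp
  also have "10 ^ Suc n \<le> 10 ^ Suc n * a (Suc n)" using a(2) by simp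
  also have "\<dots> \<le> p" unfolding a(3) dec_peel by simp
  finally have rp: "?r < 10 * p" by simp
  have neq: "p \<noteq> ?r" and vr: "v ?r = int p"
    using assms by (simp_all add: v_palindrome_def v_prime)
  obtain k q where kq: "0 < k" "k \<le> 10" "prime q" "?r = k * q" "coprime k q"
    using large_v_structure[of ?r] rpos rp p vr by auto
  have "k \<noteq> 10" using not10 kq(4) by auto
  moreover have "k \<noteq> 1" using kq vr neq v_prime by auto
  moreover have "int p = v k + int q"
    using vr kq v_mult_coprime[of k q] v_prime[of q] prime_ge_1_nat[of q] by simp
  ultimately show thesis using that[of q k] kq by simp
qed

lemma v_palindrome_prime_form:
  assumes "prime p" "v_palindrome p"
  shows "\<exists>m. p = 5 * 10 ^ m - 1 \<and> prime (5 * 10 ^ m - 3 :: nat)"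
proof -
  have p: "p \<ge> 121" using v_palindrome_prime_ge_121 assms .
  then have "p \<ge> 10" by simp
  then obtain a n where a: "\<And>i. a i \<le> 9" "a (Suc n) \<noteq> 0" "p = dec a (Suc (Suc n))"
    "digit_reverse p = rdec a (Suc (Suc n))" by (rule obtain_digits) blast
  obtain k q where kq: "prime q" "1 < k" "k < 10" "digit_reverse p = k * q" "int p = v k + int q"
    using v_palindrome_prime_reverse assms by blast
  \<comment> \<open>Here \<open>x\<close> and \<open>y\<close> are the first and last digits of
    \<open>p\<close>, \<open>t\<close> is the inner block, \<open>s\<close> its reversal, and
    \<open>10 * B\<close> the weight of the leading digit.\<close>
  define x y t s B c r where "x = a (Suc n)" and "y = a 0" and "t = dec (\<lambda>i. a (Suc i)) n"
    and "s = rdec (\<lambda>i. a (Suc i)) n" and "B = (10::nat) ^ n" and "c = k * nat (v k)"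
    and "r = digit_reverse p"
  have s: "s < B" unfolding s_def B_def using a(1) by (intro rdec_less)
  have x: "1 \<le> x" "x \<le> 9" using a(1,2) unfolding x_def by (auto simp: Suc_le_eq)
  have y: "y \<le> 9" unfolding y_def using a(1) .
  have p_eq: "p = y + 10 * t + 10 * B * x"
    unfolding a(3) dec_peel x_def y_def t_def B_def by simp
  have r_eq: "r = x + 10 * s + 10 * B * y"
    unfolding r_def a(4) rdec_peel x_def y_def s_def B_def by simp
  have kc: "(k, c) \<in> set [(2, 4), (3, 9), (4, 16), (5, 25), (6, 30), (7, 49), (8, 40), (9, 45)]"
    unfolding c_def using kq(2,3) by (intro mult_v_2_to_9) auto
  \<comment> \<open>Nonnegativity makes the passage to naturals lossless; multiplying
    \<open>p = v k + q\<close> by \<open>k\<close> then gives \<open>key\<close>.\<close>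
  have "v k \<ge> 0" by (simp add: v_def sum_nonneg)
  then have "p = nat (v k) + q" using kq(5) by linarith
  then have key: "r + c = k * p"
    unfolding r_def kq(4) c_def by (simp add: algebra_simps)
  \<comment> \<open>At least three digits are needed so that \<open>10 * B \<ge> 100\<close> exceeds
    every tabulated \<open>c\<close>, the largest being 49.\<close>
  have "n \<noteq> 0"
  proof
    assume "n = 0"
    then have "t = 0" "B = 1" by (simp_all add: t_def B_def dec_def)
    then show False using p p_eq x y by simp
  qed
  then have B: "B \<ge> 10" unfolding B_def using self_le_power[of 10 n] by simp
  have last_digits: "(x + c) mod 10 = k * y mod 10"
  proof -
    have "x + c + 10 * (s + B * y) = k * y + 10 * (k * t + k * B * x)"
      using key unfolding r_eq p_eq by (simp add: algebra_simps)
    then have "(x + c + 10 * (s + B * y)) mod 10 = (k * y + 10 * (k * t + k * B * x)) mod 10"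
      by simp
    then show ?thesis by (simp only: mod_mult_self2)
  qed
  have c: "c < 10 * B" using kc B by auto
  \<comment> \<open>In \<open>key\<close> the inner block of \<open>p\<close> is dropped on one
    side, and \<open>x + 10 * s < 10 * B\<close> is used on the other.\<close>
  have bound: "k * x * (10 * B) + k * y < (y + 1) * (10 * B) + c"
  proof -
    have "k * y + k * x * (10 * B) \<le> r + c"
      unfolding key p_eq by (simp add: algebra_simps)
    also have "r < (y + 1) * (10 * B)"
      using r_eq s x(2) by (simp add: algebra_simps)
    finally show ?thesis by simp
  qed
  have "k * x * (10 * B) < (y + 2) * (10 * B)"
    using bound c by (simp add: algebra_simps)
  then have first1: "k * x \<le> y + 1" by (simp only: mult_less_cancel2) simp
  \<comment> \<open>In the extremal case the leading terms of \<open>bound\<close> cancel, which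
    leaves a comparison of the lower-order terms.\<close>
  have first2: "k * y < c" if "k * x = y + 1" using bound unfolding that by simp
  have "p mod 10 = (y + 10 * (t + B * x)) mod 10" unfolding p_eq by (simp add: algebra_simps)
  also have "\<dots> = y" unfolding mod_mult_self2 using y by simp
  finally have "y \<in> set [1, 3, 7, 9]" using last_digit_of_prime[OF assms(1)] p by simp
  moreover have "x \<in> set [1, 2, 3, 4, 5, 6, 7, 8, 9]" using x by simp presburger
  ultimately consider "k = 2" "x = 4" "y = 9" | "k = 3"
    using outer_digits[OF kc _ _ last_digits first1 first2] by metis
  then show ?thesis
  proof cases
    case 1
    have "c = 4" using kc 1 by simp
    then have "s + B = 1 + 2 * t" using key 1 unfolding r_eq p_eq by simp
    then have "t + 1 = B"
      unfolding s_def B_def t_def using a(1) by (intro all_nines)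
    then have "p + 1 = 5 * 10 ^ Suc n" using p_eq 1 B_def by simp
    moreover have "p = 2 + q" using kq(5) 1 v_prime[of 2] by simp
    ultimately have "p = 5 * 10 ^ Suc n - 1" "q = 5 * 10 ^ Suc n - 3" by linarith+
    then show ?thesis using kq(1) by blast
  next
    case 2
    have "c = 9" using kc 2 by simp
    \<comment> \<open>The offset 9 vanishes modulo 9 and \<open>r\<close> is congruent to
      \<open>p\<close>, so 9 divides \<open>2 * p\<close>. This forces \<open>p = 3\<close>.\<close>
    then have "r + 9 = 3 * p" using key 2 by simp
    moreover have "r mod 9 = p mod 9"
      using rdec_mod_9[of a "Suc (Suc n)"] a(3,4) r_def by simp
    ultimately have "3 * p mod 9 = p mod 9" by (metis mod_add_self2)
    then have "9 dvd 3 * p - p" by (subst mod_eq_dvd_iff_nat[symmetric]) simp_all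
    then have "3 dvd 2 * p" using dvd_trans[of 3 9 "2 * p"] by simp
    then have "3 dvd p" using prime_dvd_mult_nat[of 3 2 p] by auto
    then have "p = 3" using prime_eq_divisor[OF assms(1)] by simp
    then show ?thesis using p by simp
  qed
qed

section \<open>The reverse of 49...9 and the equivalence\<close>

lemma sum_nines: "(\<Sum>i<m. 9 * 10 ^ i) + 1 = (10::nat) ^ m"
  by (induction m) auto

text \<open>The reverse is 9...94, which is twice \<open>5 * 10 ^ m - 3\<close>. For
  \<open>m = 0\<close> both sides are 4, so truncated subtraction does no harm.\<close>

lemma digit_reverse_49: "digit_reverse (5 * 10 ^ m - 1) = 10 ^ Suc m - 6"
proof -
  define a :: "nat \<Rightarrow> nat" where "a = (\<lambda>i. if i < m then 9 else 4)"
  have "(\<Sum>i<Suc m. a i * 10 ^ i) = (\<Sum>i<m. 9 * 10 ^ i) + 4 * 10 ^ m"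
    by (simp add: a_def)
  also have "\<dots> = 5 * 10 ^ m - 1" using sum_nines[of m] by linarith
  finally have 1: "(\<Sum>i<Suc m. a i * 10 ^ i) = 5 * 10 ^ m - 1" .
  have "(\<Sum>i<Suc m. a (Suc m - 1 - i) * 10 ^ i) = 4 + 10 * (\<Sum>i<m. 9 * 10 ^ i)"
    unfolding sum.lessThan_Suc_shift by (simp add: a_def sum_distrib_left ac_simps)
  also have "\<dots> = 10 ^ Suc m - 6" using sum_nines[of m] by simp
  finally show ?thesis
    using digit_reverse_decimal[of "Suc m" a] unfolding 1 by (simp add: a_def)
qed

theorem theorem1p1:
  "{p :: nat. prime p \<and> v_palindrome p} =
   {p :: nat. prime p \<and> (\<exists>m\<ge>4. p = 5 * 10 ^ m - 1 \<and> prime (5 * 10 ^ m - 3 :: nat))}"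
proof (intro Collect_cong conj_cong refl iffI)
  fix p :: nat
  assume "prime p" "v_palindrome p"
  then obtain m where m: "p = 5 * 10 ^ m - 1" "prime (5 * 10 ^ m - 3 :: nat)"
    using v_palindrome_prime_form by blast
  have np: "\<not> prime (d * e)" if "d > 1" "e > 1" for d e :: nat
    using prime_product[of d e] that by auto
  have "p \<ge> 121" using v_palindrome_prime_ge_121 \<open>prime p\<close> \<open>v_palindrome p\<close> .
  \<comment> \<open>These exponents give 4 and 49, both below 121. The next two are excluded because
    497 and 4997 are composite.\<close>
  then have "m \<noteq> 0" "m \<noteq> 1" using m(1) by (auto intro!: Nat.gr0I)
  moreover have "m \<noteq> 2"
  proof
    assume "m = 2"
    then have "5 * 10 ^ m - 3 = (7 * 71 :: nat)" by simp
    with m(2) np[of 7 71] show False by (simp only:)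
  qed
  moreover have "m \<noteq> 3"
  proof
    assume "m = 3"
    then have "5 * 10 ^ m - 3 = (19 * 263 :: nat)" by simp
    with m(2) np[of 19 263] show False by (simp only:)
  qed
  ultimately have "m \<ge> 4" by linarith
  with m show "\<exists>m\<ge>4. p = 5 * 10 ^ m - 1 \<and> prime (5 * 10 ^ m - 3 :: nat)" by blast
next
  fix p :: nat
  assume p: "prime p" and "\<exists>m\<ge>4. p = 5 * 10 ^ m - 1 \<and> prime (5 * 10 ^ m - 3 :: nat)"
  then obtain m where m: "m \<ge> 4" "p = 5 * 10 ^ m - 1" "prime (5 * 10 ^ m - 3 :: nat)" by blast
  define q :: nat where "q = 5 * 10 ^ m - 3"
  have "(10::nat) ^ 4 \<le> 10 ^ m" using m(1) by (intro power_increasing) auto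
  then have big: "(10::nat) ^ m \<ge> 10000" by simp
  have q: "prime q" "q > 2" "p = q + 2" using m big unfolding q_def by auto
  \<comment> \<open>As \<open>q\<close> is an odd prime, \<open>v (2 * q) = 2 + q = p\<close>;
    moreover \<open>q > 2\<close> makes \<open>2 * q\<close> differ from
    \<open>p = q + 2\<close>.\<close>
  have r: "digit_reverse p = 2 * q" unfolding m(2) digit_reverse_49 q_def by simp
  have "v (2 * q) = int p" using v_mult_primes[of 2 q] q by simp
  moreover have "\<not> 10 dvd p"
  proof
    assume "10 dvd p"
    then have "p = 10" using prime_eq_divisor[OF p] by simp
    then show False using m(2) big by linarith
  qed
  ultimately show "v_palindrome p"
    unfolding v_palindrome_def r using p q v_prime[of p] by auto
qed

end
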